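(* Let $f:\mathbb{R}^d\to\mathbb{R}$ be continuously differentiable and globally $L$-smooth, i.e. $\|\nabla f(x)-\nabla f(y)\|\le L\|x-y\|$ for all $x,y\in\mathbb{R}^d$. Assume that $f$ has a finite infimum $f_\star:=\inf_{x\in\mathbb{R}^d}f(x)>-\infty$, and that there exist $\tau>0$ and $\alpha\in[1,2)$ such that $$f(x)-f_\star\le \tau\|\nabla f(x)\|^\alpha\qquad\text{for all }x\in\mathbb{R}^d.$$ Then $f$ is constant on $\mathbb{R}^d$.
   Context: $\|\cdot\|$ denotes the Euclidean norm. *)

theory Defs
  imports "HOL-Analysis.Analysis"
begin

end

theory Submission
  imports Defs
begin

text \<open>A function that has Lipschitz gradient and is bounded below satisfies
  \<open>norm (grad x)\<^sup>2 \<le> C * (f x - inf f)\<close>. Together with the domination hypothesis and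
  \<open>\<alpha> < 2\<close> this bounds the gradient, and hence \<open>f\<close> from above. The same estimate
  for \<open>-f\<close> makes the gradient small where \<open>f\<close> is close to its supremum, while the domination
  hypothesis keeps it away from \<open>0\<close> on \<open>{x. f x \<ge> f x0}\<close> if \<open>f x0 > inf f\<close>.\<close>

text \<open>One gradient descent step from \<open>x\<close> lowers \<open>f\<close> by at least
  \<open>(norm (grad x))\<^sup>2 / (4 * K)\<close>, yet cannot take it below
  \<open>m\<close>.\<close>

lemma norm_gradient_sq_le:
  fixes f :: "'a::real_inner \<Rightarrow> real" and grad :: "'a \<Rightarrow> 'a"
  assumes grad: "\<And>x. GDERIV f x :> grad x"
    and lip: "\<And>x y. norm (grad x - grad y) \<le> K * norm (x - y)"
    and K: "K > 0"
    and lower: "\<And>x. m \<le> f x"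
  shows "(norm (grad x))\<^sup>2 \<le> 4 * K * (f x - m)"
proof -
  \<comment> \<open>The step size \<open>1 / (2 * K)\<close> minimises
    \<open>- s + K * s\<^sup>2\<close>, the factor of \<open>(norm (grad x))\<^sup>2\<close> in the
    upper bound for the change of \<open>f\<close> along
    \<open>- s *\<^sub>R grad x\<close>.\<close>
  define h where "h = - (1 / (2 * K)) *\<^sub>R grad x"
  have "((\<lambda>t. f (x + t *\<^sub>R h)) has_real_derivative grad (x + t *\<^sub>R h) \<bullet> h) (at t)" for t
  proof -
    have "((\<lambda>t. x + t *\<^sub>R h) has_derivative (\<lambda>t. t *\<^sub>R h)) (at t)"
      by (auto intro!: derivative_eq_intros)
    from has_derivative_compose[OF this grad[unfolded gderiv_def]]
    show ?thesis
      unfolding has_field_derivative_def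
      by (rule has_derivative_eq_rhs) (auto simp: fun_eq_iff inner_commute)
  qed
  then obtain t where t: "0 < t" "t < 1" "f (x + 1 *\<^sub>R h) - f (x + 0 *\<^sub>R h) = grad (x + t *\<^sub>R h) \<bullet> h"
    using MVT2[of 0 1 "\<lambda>t. f (x + t *\<^sub>R h)" "\<lambda>t. grad (x + t *\<^sub>R h) \<bullet> h"] by auto
  \<comment> \<open>The mean value point is unknown, so only \<open>t < 1\<close> is used; this
    gives \<open>K\<close> as the quadratic coefficient.\<close>
  have "(grad (x + t *\<^sub>R h) - grad x) \<bullet> h \<le> norm (grad (x + t *\<^sub>R h) - grad x) * norm h"
    by (rule norm_cauchy_schwarz)
  also have "\<dots> \<le> K * norm (t *\<^sub>R h) * norm h"
    using lip[of "x + t *\<^sub>R h" x] by (intro mult_right_mono) auto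
  also have "\<dots> = t * (K * (norm h)\<^sup>2)"
    using t by (simp add: power2_eq_square)
  also have "\<dots> \<le> K * (norm h)\<^sup>2"
    using t K by (intro mult_left_le_one_le) auto
  finally have "m \<le> f x + grad x \<bullet> h + K * (norm h)\<^sup>2"
    using t(3) lower[of "x + h"] by (simp add: inner_diff_left)
  also have "\<dots> = f x - (norm (grad x))\<^sup>2 / (4 * K)"
    using K by (simp add: h_def dot_square_norm divide_simps power2_eq_square)
  finally show ?thesis
    using K by (simp add: field_simps)
qed

theorem theorem2p1:
  fixes f :: "(real ^ 'd) \<Rightarrow> real"
    and grad :: "(real ^ 'd) \<Rightarrow> (real ^ 'd)"
    and L \<tau> \<alpha> :: real
  assumes grad_f: "\<And>x. GDERIV f x :> grad x"
    and cont: "continuous_on UNIV grad"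
    and smooth: "\<And>x y. norm (grad x - grad y) \<le> L * norm (x - y)"
    and bdd: "bdd_below (range f)"
    and tau: "\<tau> > 0"
    and alpha: "1 \<le> \<alpha>" "\<alpha> < 2"
    and dominated: "\<And>x. f x - (INF y. f y) \<le> \<tau> * norm (grad x) powr \<alpha>"
  shows "f constant_on UNIV"
proof -
  \<comment> \<open>\<open>L\<close> may be zero or negative, but the lemma divides by its
    constant.\<close>
  define K where "K = max L 1"
  define m where "m = (INF y. f y)"
  have K: "K > 0"
    by (simp add: K_def)
  have lip: "norm (grad x - grad y) \<le> K * norm (x - y)" for x y
    by (rule order_trans[OF smooth]) (simp add: K_def mult_right_mono)
  have m: "m \<le> f x" for x
    unfolding m_def by (rule cINF_lower[OF bdd UNIV_I])
  have dom: "f x - m \<le> \<tau> * norm (grad x) powr \<alpha>" for x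
    using dominated by (simp add: m_def)
  \<comment> \<open>The positive solution of
    \<open>R\<^sup>2 = 4 * K * \<tau> * R powr \<alpha>\<close>.\<close>
  define R where "R = (4 * K * \<tau>) powr (1 / (2 - \<alpha>))"
  have "norm (grad x) \<le> R" for x
  proof (cases "grad x = 0")
    case False
    define r where "r = norm (grad x)"
    have r: "r > 0"
      using False by (simp add: r_def)
    \<comment> \<open>Splitting off \<open>r powr \<alpha>\<close> lets it cancel; the remaining
      exponent \<open>2 - \<alpha>\<close> is positive, so the bound can be inverted.\<close>
    have "r powr \<alpha> * r powr (2 - \<alpha>) = r\<^sup>2"
      using r by (simp flip: powr_add)
    also have "\<dots> \<le> 4 * K * (f x - m)"
      unfolding r_def by (rule norm_gradient_sq_le[OF grad_f lip K m])
    also have "\<dots> \<le> 4 * K * (\<tau> * r powr \<alpha>)"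
      using K dom[of x] by (intro mult_left_mono) (auto simp: r_def)
    finally have "r powr \<alpha> * r powr (2 - \<alpha>) \<le> r powr \<alpha> * (4 * K * \<tau>)"
      by (simp add: mult_ac)
    then have "r powr (2 - \<alpha>) \<le> 4 * K * \<tau>"
      using r by simp
    then have "(r powr (2 - \<alpha>)) powr (1 / (2 - \<alpha>)) \<le> R"
      unfolding R_def using alpha by (intro powr_mono2) auto
    then show ?thesis
      using alpha r by (simp add: powr_powr r_def)
  qed (simp add: R_def)
  then have "f x \<le> m + \<tau> * R powr \<alpha>" for x
    using dom[of x] alpha tau mult_left_mono[OF powr_mono2[of \<alpha> "norm (grad x)" R], of \<tau>]
    by (smt (verit) norm_ge_zero)
  then have bdd': "bdd_above (range f)"
    by (intro bdd_aboveI2)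
  define S where "S = (SUP y. f y)"
  have S: "f x \<le> S" for x
    unfolding S_def by (rule cSUP_upper[OF UNIV_I bdd'])
  have "GDERIV (\<lambda>x. - f x) x :> - grad x" for x
    using grad_f by (rule GDERIV_minus)
  moreover have "norm (- grad x - - grad y) \<le> K * norm (x - y)" for x y
    using lip[of x y] by (simp add: norm_minus_commute)
  ultimately have grad_S: "(norm (grad x))\<^sup>2 \<le> 4 * K * (S - f x)" for x
    using norm_gradient_sq_le[of "\<lambda>x. - f x" "\<lambda>x. - grad x" K "-S" x] K S by simp
  have "f x0 = m" for x0
  proof (rule ccontr)
    assume "f x0 \<noteq> m"
    then have pos: "f x0 - m > 0"
      using m[of x0] by simp
    \<comment> \<open>The gradient norm at which the domination bound equals
      \<open>f x0 - m\<close>.\<close>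
    define c where "c = ((f x0 - m) / \<tau>) powr (1 / \<alpha>)"
    have c: "c > 0"
      using pos tau by (simp add: c_def)
    have above: "f x \<le> S - c\<^sup>2 / (4 * K)" if "f x \<ge> f x0" for x
    proof -
      have "(f x0 - m) / \<tau> \<le> norm (grad x) powr \<alpha>"
        using dom[of x] that tau by (simp add: field_simps)
      then have "c \<le> (norm (grad x) powr \<alpha>) powr (1 / \<alpha>)"
        unfolding c_def using pos tau alpha by (intro powr_mono2) auto
      then have "c \<le> norm (grad x)"
        using alpha by (simp add: powr_powr)
      then have "c\<^sup>2 \<le> (norm (grad x))\<^sup>2"
        using c by (intro power_mono) auto
      then show ?thesis
        using grad_S[of x] K by (simp add: field_simps)
    qed
    \<comment> \<open>If \<open>f x < f x0\<close>, the bound at \<open>x0\<close> already covers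
      \<open>x\<close>. Thus a number strictly below the supremum \<open>S\<close> bounds all values
      of \<open>f\<close>.\<close>
    have "f x \<le> S - c\<^sup>2 / (4 * K)" for x
      using above[of x] above[of x0] by linarith
    then have "S \<le> S - c\<^sup>2 / (4 * K)"
      by (subst S_def) (rule cSUP_least, auto)
    then show False
      using c K by (simp add: field_simps)
  qed
  then show ?thesis
    by (auto simp: constant_on_def)
qed

end
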